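(* Every crowded monotonically normal topological space $X$ is almost $\min(2^{\omega},\omega_2)$-resolvable. Thus $X$ is almost $\omega_1$-resolvable, and it is even almost $\omega_2$-resolvable if the continuum hypothesis fails.
   Context: A topological space is crowded if it has no isolated points. A space $X$ is almost $\kappa$-resolvable if there is a family $\{D_\alpha:\alpha<\kappa\}$ of dense subsets of $X$ such that $D_\alpha\cap D_\beta$ is nowhere dense in $X$ whenever $\alpha\neq\beta$. For a topological space $X$ with topology $\tau(X)$, let $\mathcal{M}(X)=\{\langle x,U\rangle\in X\times\tau(X): x\in U\}$. The space $X$ is monotonically normal if it is $T_1$ and there is a function $H:\mathcal{M}(X)\to\tau(X)$ (a monotone normality operator) such that (1) $x\in H(x,U)\subseteq U$ for each $\langle x,U\rangle\in\mathcal{M}(X)$; (2) if $H(x,U)\cap H(y,V)\neq\emptyset$ then $x\in V$ or $y\in U$. *)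

theory Defs
  imports "HOL-Analysis.Analysis"
begin

unbundle cardinal_syntax

text \<open>Cardinals are cardinal orders in the sense of
  \<^theory>\<open>HOL.BNF_Cardinal_Order_Relation\<close>; the ordinals below such a cardinal are the
  elements of its field.\<close>

abbreviation omega1 :: "nat set rel"
  where "omega1 \<equiv> cardSuc natLeq"

abbreviation omega2 :: "nat set set rel"
  where "omega2 \<equiv> cardSuc omega1"

abbreviation continuum :: "(nat \<Rightarrow> bool) rel"
  where "continuum \<equiv> ctwo ^c natLeq"

text \<open>The two cardinals may live on different types, so their minimum is placed on the sum type.\<close>

definition cmin :: "'a rel \<Rightarrow> 'b rel \<Rightarrow> ('a + 'b) rel"
  where "cmin r s = (if r \<le>o s then dir_image r Inl else dir_image s Inr)"

lemma cmin_ordIso: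
  assumes "Card_order r" and "Card_order s"
  shows "r \<le>o s \<Longrightarrow> cmin r s =o r" and "s \<le>o r \<Longrightarrow> cmin r s =o s"
proof -
  have r: "dir_image r (Inl :: 'a \<Rightarrow> 'a + 'b) =o r" and s: "dir_image s (Inr :: 'b \<Rightarrow> 'a + 'b) =o s"
    using assms by (simp_all add: dir_image ordIso_symmetric)
  show "r \<le>o s \<Longrightarrow> cmin r s =o r"
    using r by (simp add: cmin_def)
  show "s \<le>o r \<Longrightarrow> cmin r s =o s"
    using r s ordIso_transitive ordIso_iff_ordLeq by (fastforce simp: cmin_def)
qed

lemma Card_order_cmin:
  assumes "Card_order r" and "Card_order s"
  shows "Card_order (cmin r s)"
  using assms cmin_ordIso Card_order_ordIso ordLeq_total
  by (metis card_order_on_well_order_on)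

definition crowded_space :: "'a topology \<Rightarrow> bool"
  where "crowded_space X \<longleftrightarrow> (\<forall>x \<in> topspace X. \<not> openin X {x})"

definition dense_in :: "'a topology \<Rightarrow> 'a set \<Rightarrow> bool"
  where "dense_in X D \<longleftrightarrow> D \<subseteq> topspace X \<and> X closure_of D = topspace X"

definition nowhere_dense_in :: "'a topology \<Rightarrow> 'a set \<Rightarrow> bool"
  where "nowhere_dense_in X A \<longleftrightarrow> A \<subseteq> topspace X \<and> X interior_of (X closure_of A) = {}"

definition almost_resolvable :: "'k rel \<Rightarrow> 'a topology \<Rightarrow> bool"
  where "almost_resolvable \<kappa> X \<longleftrightarrow>
    (\<exists>D :: 'k \<Rightarrow> 'a set.
      (\<forall>\<alpha> \<in> Field \<kappa>. dense_in X (D \<alpha>)) \<and>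
      (\<forall>\<alpha> \<in> Field \<kappa>. \<forall>\<beta> \<in> Field \<kappa>. \<alpha> \<noteq> \<beta> \<longrightarrow> nowhere_dense_in X (D \<alpha> \<inter> D \<beta>)))"

definition pointed_opens :: "'a topology \<Rightarrow> ('a \<times> 'a set) set"
  where "pointed_opens X = {(x, U). openin X U \<and> x \<in> U}"

definition monotone_normality_operator :: "'a topology \<Rightarrow> ('a \<times> 'a set \<Rightarrow> 'a set) \<Rightarrow> bool"
  where "monotone_normality_operator X H \<longleftrightarrow>
    (\<forall>(x, U) \<in> pointed_opens X. openin X (H (x, U)) \<and> x \<in> H (x, U) \<and> H (x, U) \<subseteq> U) \<and>
    (\<forall>(x, U) \<in> pointed_opens X. \<forall>(y, V) \<in> pointed_opens X.
      H (x, U) \<inter> H (y, V) \<noteq> {} \<longrightarrow> x \<in> V \<or> y \<in> U)"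

definition monotonically_normal_space :: "'a topology \<Rightarrow> bool"
  where "monotonically_normal_space X \<longleftrightarrow>
    t1_space X \<and> (\<exists>H. monotone_normality_operator X H)"

end

theory Submission
  imports Defs "HOL-Library.Countable_Set_Type"
begin

text \<open>By gluing over a maximal disjoint family of open sets, it suffices to work in some nonempty
  open set. In a crowded monotonically normal space every nowhere dense set lies in the closure of
  a nowhere dense set disjoint from it. Let \<open>\<lambda>\<close> be the least size of a family \<open>F\<close> of nowhere dense
  sets whose union is somewhere dense. Since unions of fewer than \<open>\<lambda>\<close> nowhere dense sets are
  nowhere dense, recursion yields \<open>\<lambda>\<close> pairwise disjoint nowhere dense sets \<open>L (A, B)\<close> accumulating
  at every point of \<open>A\<close>, for each \<open>A \<in> F\<close>. Functions \<open>f\<^sub>\<alpha>\<close> on \<open>F\<close> that pairwise agree on fewer than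
  \<open>\<lambda>\<close> arguments then give the sets \<open>\<Union>A\<in>F. L (A, f\<^sub>\<alpha> A)\<close>; there are \<open>2\<^sup>\<omega>\<close> such functions if
  \<open>\<lambda> = \<omega>\<close>, and at least \<open>\<omega>\<^sub>2\<close> if \<open>\<lambda>\<close> is uncountable.\<close>

section \<open>Dense and nowhere dense sets in terms of open sets\<close>

lemma dense_in_iff:
  "dense_in X D \<longleftrightarrow> D \<subseteq> topspace X \<and> (\<forall>U. openin X U \<longrightarrow> U \<noteq> {} \<longrightarrow> U \<inter> D \<noteq> {})"
  unfolding dense_in_def dense_intersects_open by blast

text \<open>An open set not contained in the closure of \<open>A\<close> stays open and nonempty
  after removing that closure; conversely, an open set missing \<open>A\<close> also misses its
  closure.\<close>

lemma nowhere_dense_in_iff: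
  "nowhere_dense_in X A \<longleftrightarrow>
    A \<subseteq> topspace X \<and> (\<forall>U. openin X U \<longrightarrow> U \<noteq> {} \<longrightarrow> (\<exists>V. openin X V \<and> V \<noteq> {} \<and> V \<subseteq> U \<and> V \<inter> A = {}))"
proof -
  have "X interior_of (X closure_of A) = {} \<longleftrightarrow>
    (\<forall>U. openin X U \<longrightarrow> U \<noteq> {} \<longrightarrow> (\<exists>V. openin X V \<and> V \<noteq> {} \<and> V \<subseteq> U \<and> V \<inter> A = {}))"
    if "A \<subseteq> topspace X"
  proof
    assume e: "X interior_of (X closure_of A) = {}"
    show "\<forall>U. openin X U \<longrightarrow> U \<noteq> {} \<longrightarrow> (\<exists>V. openin X V \<and> V \<noteq> {} \<and> V \<subseteq> U \<and> V \<inter> A = {})"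
    proof (intro allI impI)
      fix U assume U: "openin X U" "U \<noteq> {}"
      have "\<not> U \<subseteq> X closure_of A"
        using e U interior_of_maximal by fastforce
      moreover have "openin X (U - X closure_of A)"
        using U by (simp add: openin_diff)
      ultimately show "\<exists>V. openin X V \<and> V \<noteq> {} \<and> V \<subseteq> U \<and> V \<inter> A = {}"
        using closure_of_subset[OF that] by (intro exI[of _ "U - X closure_of A"]) blast
    qed
  next
    assume *: "\<forall>U. openin X U \<longrightarrow> U \<noteq> {} \<longrightarrow> (\<exists>V. openin X V \<and> V \<noteq> {} \<and> V \<subseteq> U \<and> V \<inter> A = {})"
    show "X interior_of (X closure_of A) = {}"
    proof (rule ccontr)
      assume "X interior_of (X closure_of A) \<noteq> {}"
      then obtain V where V: "openin X V" "V \<noteq> {}" "V \<subseteq> X interior_of (X closure_of A)" "V \<inter> A = {}"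
        using * by (metis openin_interior_of)
      then have "V \<inter> X closure_of A = {}"
        by (simp add: openin_Int_closure_of_eq_empty)
      then show False
        using V interior_of_subset by fastforce
    qed
  qed
  then show ?thesis
    unfolding nowhere_dense_in_def by blast
qed

lemma nowhere_dense_in_empty: "nowhere_dense_in X {}"
  by (simp add: nowhere_dense_in_def)

lemma nowhere_dense_in_subset:
  "nowhere_dense_in X A \<Longrightarrow> B \<subseteq> A \<Longrightarrow> nowhere_dense_in X B"
  unfolding nowhere_dense_in_iff by (meson disjoint_iff subset_iff)

lemma nowhere_dense_in_Un:
  assumes "nowhere_dense_in X A" "nowhere_dense_in X B"
  shows "nowhere_dense_in X (A \<union> B)"
  unfolding nowhere_dense_in_iff
proof (intro conjI allI impI)
  show "A \<union> B \<subseteq> topspace X"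
    using assms by (simp add: nowhere_dense_in_def)
  fix U assume "openin X U" "U \<noteq> {}"
  then obtain V where V: "openin X V" "V \<noteq> {}" "V \<subseteq> U" "V \<inter> A = {}"
    using assms(1) unfolding nowhere_dense_in_iff by meson
  then obtain W where "openin X W" "W \<noteq> {}" "W \<subseteq> V" "W \<inter> B = {}"
    using assms(2) unfolding nowhere_dense_in_iff by meson
  with V show "\<exists>V. openin X V \<and> V \<noteq> {} \<and> V \<subseteq> U \<and> V \<inter> (A \<union> B) = {}"
    by (intro exI[of _ W]) blast
qed

lemma nowhere_dense_in_Union_finite:
  "finite F \<Longrightarrow> (\<And>A. A \<in> F \<Longrightarrow> nowhere_dense_in X A) \<Longrightarrow> nowhere_dense_in X (\<Union>F)"
  by (induction F rule: finite_induct) (auto intro: nowhere_dense_in_empty nowhere_dense_in_Un)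

text \<open>Open subsets of the open subspace are open in \<open>X\<close>, so a witness found
  inside \<open>U \<inter> W\<close> serves in \<open>X\<close>; if \<open>U\<close> misses
  \<open>W\<close>, then \<open>U\<close> itself misses \<open>A\<close>.\<close>

lemma nowhere_dense_in_open_subtopology:
  assumes W: "openin X W" and A: "nowhere_dense_in (subtopology X W) A"
  shows "nowhere_dense_in X A"
  unfolding nowhere_dense_in_iff
proof (intro conjI allI impI)
  have AW: "A \<subseteq> topspace X \<inter> W"
    using A by (simp add: nowhere_dense_in_def)
  then show "A \<subseteq> topspace X" by blast
  fix U assume U: "openin X U" "U \<noteq> {}"
  show "\<exists>V. openin X V \<and> V \<noteq> {} \<and> V \<subseteq> U \<and> V \<inter> A = {}"
  proof (cases "U \<inter> W = {}")
    case True
    then show ?thesis using U AW by blast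
  next
    case False
    moreover have "openin (subtopology X W) (U \<inter> W)"
      using U W by (simp add: openin_open_subtopology openin_Int)
    ultimately obtain V where "openin (subtopology X W) V" "V \<noteq> {}" "V \<subseteq> U \<inter> W" "V \<inter> A = {}"
      using A unfolding nowhere_dense_in_iff by meson
    then show ?thesis
      using W by (auto simp: openin_open_subtopology)
  qed
qed

text \<open>The separation axiom makes \<open>U - {x}\<close> open, and the absence of isolated
  points makes it nonempty.\<close>

lemma crowded_nowhere_dense_in_singleton:
  assumes "crowded_space X" "t1_space X" "x \<in> topspace X"
  shows "nowhere_dense_in X {x}"
  unfolding nowhere_dense_in_iff
proof (intro conjI allI impI)
  fix U assume U: "openin X U" "U \<noteq> {}"
  then have "openin X (U - {x})"
    using assms by (simp add: openin_diff t1_space_closedin_singleton)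
  moreover have "U \<noteq> {x}"
    using U assms by (auto simp: crowded_space_def)
  ultimately show "\<exists>V. openin X V \<and> V \<noteq> {} \<and> V \<subseteq> U \<and> V \<inter> {x} = {}"
    using U by (intro exI[of _ "U - {x}"]) auto
qed (use assms in auto)

section \<open>Passing to open subspaces\<close>

lemma crowded_space_open_subtopology:
  "openin X W \<Longrightarrow> crowded_space X \<Longrightarrow> crowded_space (subtopology X W)"
  by (auto simp: crowded_space_def openin_open_subtopology)

lemma monotone_normality_operator_iff:
  "monotone_normality_operator X H \<longleftrightarrow>
    (\<forall>x U. openin X U \<and> x \<in> U \<longrightarrow> openin X (H (x, U)) \<and> x \<in> H (x, U) \<and> H (x, U) \<subseteq> U) \<and>
    (\<forall>x U. openin X U \<and> x \<in> U \<longrightarrow> (\<forall>y V. openin X V \<and> y \<in> V \<longrightarrow>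
      H (x, U) \<inter> H (y, V) \<noteq> {} \<longrightarrow> x \<in> V \<or> y \<in> U))"
  by (simp add: monotone_normality_operator_def pointed_opens_def Ball_def)

text \<open>The operator of \<open>X\<close> serves unchanged: open subsets of the subspace are open
  in \<open>X\<close>, and \<open>H (x, U) \<subseteq> U\<close> keeps its values inside
  \<open>W\<close>.\<close>

lemma monotonically_normal_open_subtopology:
  assumes "openin X W" "monotonically_normal_space X"
  shows "monotonically_normal_space (subtopology X W)"
proof -
  obtain H where H: "monotone_normality_operator X H"
    using assms by (auto simp: monotonically_normal_space_def)
  then have "monotone_normality_operator (subtopology X W) H"
    unfolding monotone_normality_operator_iff openin_open_subtopology[OF assms(1)]
    by (meson order_trans)
  then show ?thesis
    using assms by (auto simp: monotonically_normal_space_def intro: t1_space_subtopology)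
qed

section \<open>Maximal disjoint families and accumulation from outside a nowhere dense set\<close>

text \<open>By Zorn's lemma: an index whose set misses all members of a maximal family could be
  added to it. The family is indexed so that the pair \<open>(y, V)\<close> behind a set
  \<open>H (y, V)\<close> is remembered.\<close>

lemma exists_maximal_disjoint_family_on:
  fixes h :: "'i \<Rightarrow> 'a set"
  shows "\<exists>T\<subseteq>S. disjoint_family_on h T \<and> (\<forall>s\<in>S. h s \<noteq> {} \<longrightarrow> (\<exists>t\<in>T. h s \<inter> h t \<noteq> {}))"
proof -
  let ?A = "{T. T \<subseteq> S \<and> disjoint_family_on h T}"
  have "\<exists>M\<in>?A. \<forall>Y\<in>?A. M \<subseteq> Y \<longrightarrow> Y = M"
  proof (rule subset_Zorn')
    fix C assume C: "subset.chain ?A C"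
    then have A: "T \<subseteq> S" "disjoint_family_on h T" if "T \<in> C" for T
      using that by (auto simp: subset_chain_def)
    have "h m \<inter> h n = {}" if mn: "m \<in> \<Union>C" "n \<in> \<Union>C" "m \<noteq> n" for m n
    proof -
      obtain T T' where TT: "T \<in> C" "m \<in> T" "T' \<in> C" "n \<in> T'"
        using mn by blast
      then have "T \<subseteq> T' \<or> T' \<subseteq> T"
        using C by (auto simp: subset_chain_def)
      then show ?thesis
        using TT A(2)[of T] A(2)[of T'] mn(3) unfolding disjoint_family_on_def by (meson subsetD)
    qed
    then show "\<Union>C \<in> ?A"
      using A(1) by (simp add: disjoint_family_on_def Sup_le_iff)
  qed
  then obtain T where TA: "T \<in> ?A" and max: "\<forall>Y\<in>?A. T \<subseteq> Y \<longrightarrow> Y = T"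
    by (elim bexE) (rule that)
  then have T: "T \<subseteq> S" "disjoint_family_on h T"
    by simp_all
  have "\<exists>t\<in>T. h s \<inter> h t \<noteq> {}" if s: "s \<in> S" "h s \<noteq> {}" for s
  proof (rule ccontr)
    assume n: "\<not> ?thesis"
    then have "disjoint_family_on h (insert s T)"
      using T by (auto simp: disjoint_family_on_def)
    then have "insert s T = T"
      using max T(1) s(1) by blast
    then show False using n s by blast
  qed
  then show ?thesis
    using T by (intro exI[of _ T]) simp
qed

text \<open>If \<open>x \<in> N\<close> and \<open>U\<close> is a neighbourhood of \<open>x\<close>, then \<open>H (x, U)\<close> meets some \<open>H (y, V)\<close>
  of a maximal disjoint family with all \<open>V\<close> off the closure of \<open>N\<close>; as \<open>x \<notin> V\<close>, it follows that
  \<open>y \<in> U\<close>.\<close>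

lemma exists_nowhere_dense_accumulating:
  assumes crowded: "crowded_space X" and mn: "monotonically_normal_space X"
    and N: "nowhere_dense_in X N"
  obtains D where "nowhere_dense_in X D" "D \<inter> N = {}" "N \<subseteq> X closure_of D"
proof -
  obtain H where H: "monotone_normality_operator X H" and t1: "t1_space X"
    using mn by (auto simp: monotonically_normal_space_def)
  have H1: "openin X (H (x, U)) \<and> x \<in> H (x, U) \<and> H (x, U) \<subseteq> U" if "openin X U" "x \<in> U" for x U
    using H that unfolding monotone_normality_operator_iff by meson
  have H2: "x \<in> V \<or> y \<in> U"
    if "openin X U" "x \<in> U" "openin X V" "y \<in> V" "H (x, U) \<inter> H (y, V) \<noteq> {}" for x y U V
    using H that unfolding monotone_normality_operator_iff by meson
  define S where "S = {(y, V). openin X V \<and> y \<in> V \<and> V \<inter> N = {}}"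
  obtain T where T: "T \<subseteq> S" "disjoint_family_on H T"
    and max: "\<forall>s\<in>S. H s \<noteq> {} \<longrightarrow> (\<exists>t\<in>T. H s \<inter> H t \<noteq> {})"
    using exists_maximal_disjoint_family_on[of S H] by (elim exE conjE) (rule that)
  \<comment> \<open>The union of the sets \<open>H t\<close> is dense: \<open>W\<close> contains
    some nonempty open \<open>V\<close> off \<open>N\<close>, and
    \<open>H (y, V) \<subseteq> V\<close> meets a member by maximality.\<close>
  have meets: "\<exists>t\<in>T. W \<inter> H t \<noteq> {}" if W: "openin X W" "W \<noteq> {}" for W
  proof -
    obtain V y where V: "openin X V" "y \<in> V" "V \<subseteq> W" "V \<inter> N = {}"
      using N W unfolding nowhere_dense_in_iff by (metis all_not_in_conv)
    then have "(y, V) \<in> S" "H (y, V) \<noteq> {}" "H (y, V) \<subseteq> W"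
      using H1[of V y] by (auto simp: S_def)
    then show ?thesis
      using max by blast
  qed
  \<comment> \<open>The centres form a discrete set: each lies in its own \<open>H\<close>-set, and
    the \<open>H\<close>-sets of distinct pairs in \<open>T\<close> are disjoint.\<close>
  have disc: "H (y, V) \<inter> fst ` T = {y}" if "(y, V) \<in> T" for y V
  proof -
    have mem: "y' \<in> H (y', V')" if "(y', V') \<in> T" for y' V'
      using that T H1[of V' y'] by (auto simp: S_def)
    have "y' = y" if "(y', V') \<in> T" "y' \<in> H (y, V)" for y' V'
      using mem[OF that(1)] that T(2) \<open>(y, V) \<in> T\<close> unfolding disjoint_family_on_def by blast
    then show ?thesis
      using mem that by force
  qed
  show ?thesis
  proof
    show "fst ` T \<inter> N = {}"
      using T by (fastforce simp: S_def)
    show "N \<subseteq> X closure_of (fst ` T)"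
    proof
      fix x assume x: "x \<in> N"
      have "\<exists>y. y \<in> fst ` T \<and> y \<in> U" if U: "x \<in> U" "openin X U" for U
      proof -
        have "\<exists>t\<in>T. H (x, U) \<inter> H t \<noteq> {}"
          using meets[of "H (x, U)"] H1[of U x] U by blast
        then obtain y V where yV: "(y, V) \<in> T" "H (x, U) \<inter> H (y, V) \<noteq> {}"
          by fast
        then have "openin X V" "y \<in> V" "x \<notin> V"
          using T x by (auto simp: S_def)
        then have "y \<in> U"
          using H2 yV U by blast
        then show ?thesis
          using yV by force
      qed
      then show "x \<in> X closure_of (fst ` T)"
        using x N by (auto simp: in_closure_of nowhere_dense_in_def)
    qed
    show "nowhere_dense_in X (fst ` T)"
      unfolding nowhere_dense_in_iff
    proof (intro conjI allI impI)
      show top: "fst ` T \<subseteq> topspace X"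
      proof (rule image_subsetI)
        fix p assume "p \<in> T"
        then have "openin X (snd p)" "fst p \<in> snd p"
          using T(1) by (auto simp: S_def)
        then show "fst p \<in> topspace X"
          using openin_subset by blast
      qed
      fix U assume U: "openin X U" "U \<noteq> {}"
      then have "\<exists>t\<in>T. U \<inter> H t \<noteq> {}"
        by (rule meets)
      then obtain y V where yV: "(y, V) \<in> T" "U \<inter> H (y, V) \<noteq> {}"
        by fast
      moreover have "openin X (H (y, V))"
        using yV T H1[of V y] by (auto simp: S_def)
      moreover have "y \<in> topspace X"
        using yV(1) top by (metis fst_conv image_eqI subsetD)
      \<comment> \<open>The only centre that \<open>U \<inter> H (y, V)\<close> can contain is
        \<open>y\<close>, and a single point can be avoided by shrinking.\<close>
      ultimately obtain W where "openin X W" "W \<noteq> {}" "W \<subseteq> U \<inter> H (y, V)" "W \<inter> {y} = {}"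
        using crowded_nowhere_dense_in_singleton[OF crowded t1] U
        unfolding nowhere_dense_in_iff by (meson openin_Int)
      then show "\<exists>V. openin X V \<and> V \<noteq> {} \<and> V \<subseteq> U \<and> V \<inter> fst ` T = {}"
        using disc[OF yV(1)] by (intro exI[of _ W]) blast
    qed
  qed
qed

section \<open>Gluing local families\<close>

text \<open>A maximal disjoint family of open sets \<open>G\<close> carrying such a \<open>D\<close>
  has dense union. By disjointness, density and nowhere density of the glued sets can be tested
  inside a single member.\<close>

lemma almost_resolvable_if_locally:
  fixes \<kappa> :: "'k rel" and X :: "'a topology"
  assumes loc: "\<And>W. openin X W \<Longrightarrow> W \<noteq> {} \<Longrightarrow>
    \<exists>G (D :: 'k \<Rightarrow> 'a set). openin X G \<and> G \<noteq> {} \<and> G \<subseteq> W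
      \<and> (\<forall>\<alpha>\<in>Field \<kappa>. D \<alpha> \<subseteq> G \<and> G \<subseteq> X closure_of D \<alpha>)
      \<and> (\<forall>\<alpha>\<in>Field \<kappa>. \<forall>\<beta>\<in>Field \<kappa>. \<alpha> \<noteq> \<beta> \<longrightarrow> nowhere_dense_in X (D \<alpha> \<inter> D \<beta>))"
  shows "almost_resolvable \<kappa> X"
proof -
  define P where "P G D \<longleftrightarrow> openin X G \<and> G \<noteq> {}
      \<and> (\<forall>\<alpha>\<in>Field \<kappa>. D \<alpha> \<subseteq> G \<and> G \<subseteq> X closure_of D \<alpha>)
      \<and> (\<forall>\<alpha>\<in>Field \<kappa>. \<forall>\<beta>\<in>Field \<kappa>. \<alpha> \<noteq> \<beta> \<longrightarrow> nowhere_dense_in X (D \<alpha> \<inter> D \<beta>))"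
    for G and D :: "'k \<Rightarrow> 'a set"
  obtain T where T: "T \<subseteq> {G. \<exists>D. P G D}" "disjoint_family_on id T"
    and max: "\<forall>G\<in>{G. \<exists>D. P G D}. id G \<noteq> {} \<longrightarrow> (\<exists>t\<in>T. id G \<inter> id t \<noteq> {})"
    using exists_maximal_disjoint_family_on[of "{G. \<exists>D. P G D}" id] by (elim exE conjE) (rule that)
  define D where "D G = (SOME D. P G D)" for G
  have D: "P G (D G)" if "G \<in> T" for G
    unfolding D_def using T(1) that by (intro someI_ex[of "P G"]) blast
  have meets: "\<exists>G\<in>T. W \<inter> G \<noteq> {}" if W: "openin X W" "W \<noteq> {}" for W
  proof -
    obtain G' D' where "P G' D'" "G' \<subseteq> W" "G' \<noteq> {}"
      using loc[of W] W unfolding P_def by metis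
    moreover have "\<exists>G\<in>T. G' \<inter> G \<noteq> {}"
      using max calculation by (simp only: id_apply Ball_def mem_Collect_eq) blast
    ultimately show ?thesis by blast
  qed
  define E where "E \<alpha> = (\<Union>G\<in>T. D G \<alpha>)" for \<alpha>
  \<comment> \<open>Other members of \<open>T\<close> are disjoint from \<open>G\<close> and
    contribute nothing there.\<close>
  have E_Int: "E \<alpha> \<inter> G = D G \<alpha>" if "G \<in> T" "\<alpha> \<in> Field \<kappa>" for G \<alpha>
  proof -
    have "D G' \<alpha> \<subseteq> G'" if "G' \<in> T" for G'
      using D[OF that] \<open>\<alpha> \<in> Field \<kappa>\<close> by (simp add: P_def)
    then show ?thesis
      using that T(2) unfolding E_def disjoint_family_on_def by fastforce
  qed
  have E_sub: "E \<alpha> \<subseteq> topspace X" if "\<alpha> \<in> Field \<kappa>" for \<alpha>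
    unfolding E_def
  proof (rule UN_least)
    fix G assume "G \<in> T"
    then show "D G \<alpha> \<subseteq> topspace X"
      using D[of G] that openin_subset unfolding P_def by blast
  qed
  have "dense_in X (E \<alpha>)" if \<alpha>: "\<alpha> \<in> Field \<kappa>" for \<alpha>
    unfolding dense_in_iff
  proof (intro conjI allI impI)
    show "E \<alpha> \<subseteq> topspace X" using E_sub[OF \<alpha>] .
    fix U assume U: "openin X U" "U \<noteq> {}"
    then obtain G where G: "G \<in> T" "U \<inter> G \<noteq> {}"
      using meets by blast
    then have "openin X (U \<inter> G)" "G \<subseteq> X closure_of D G \<alpha>"
      using D[of G] U \<alpha> by (auto simp: P_def openin_Int)
    then have "U \<inter> G \<inter> D G \<alpha> \<noteq> {}"
      using G openin_Int_closure_of_eq_empty[of X "U \<inter> G" "D G \<alpha>"] by blast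
    then show "U \<inter> E \<alpha> \<noteq> {}"
      using G by (auto simp: E_def)
  qed
  moreover have "nowhere_dense_in X (E \<alpha> \<inter> E \<beta>)"
    if \<alpha>\<beta>: "\<alpha> \<in> Field \<kappa>" "\<beta> \<in> Field \<kappa>" "\<alpha> \<noteq> \<beta>" for \<alpha> \<beta>
    unfolding nowhere_dense_in_iff
  proof (intro conjI allI impI)
    show "E \<alpha> \<inter> E \<beta> \<subseteq> topspace X" using E_sub[OF \<alpha>\<beta>(1)] by blast
    fix U assume U: "openin X U" "U \<noteq> {}"
    then obtain G where G: "G \<in> T" "U \<inter> G \<noteq> {}"
      using meets by blast
    have "openin X (U \<inter> G)" "nowhere_dense_in X (D G \<alpha> \<inter> D G \<beta>)"
      using D[OF G(1)] U \<alpha>\<beta> by (auto simp: P_def openin_Int)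
    then obtain V where V: "openin X V" "V \<noteq> {}" "V \<subseteq> U \<inter> G" "V \<inter> (D G \<alpha> \<inter> D G \<beta>) = {}"
      using G unfolding nowhere_dense_in_iff by meson
    then show "\<exists>V. openin X V \<and> V \<noteq> {} \<and> V \<subseteq> U \<and> V \<inter> (E \<alpha> \<inter> E \<beta>) = {}"
      using E_Int[OF G(1)] \<alpha>\<beta> by (intro exI[of _ V]) blast
  qed
  ultimately show ?thesis
    unfolding almost_resolvable_def by blast
qed

section \<open>Functions that pairwise agree on few arguments\<close>

text \<open>An infinite cardinal has no last element, so the segment up to and including
  \<open>a\<close> lies strictly below some later \<open>b\<close>, and proper segments of a
  cardinal are smaller than it.\<close>

lemma card_of_under_ordLess:
  assumes r: "Card_order r" "infinite (Field r)" and a: "a \<in> Field r"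
  shows "|under r a| <o r"
proof -
  obtain b where b: "b \<in> Field r" "a \<noteq> b" "(a, b) \<in> r"
    using infinite_Card_order_limit[OF r a] by blast
  have "Well_order r"
    using r(1) by (simp add: card_order_on_def)
  then have ta: "trans r" "antisym r"
    by (simp_all add: order_on_defs)
  have "under r a \<subseteq> underS r b"
    unfolding under_def underS_def using b transD[OF ta(1)] antisymD[OF ta(2)] by blast
  then show ?thesis
    using card_of_underS[OF r(1) b(1)] card_of_mono1 ordLeq_ordLess_trans by blast
qed

text \<open>Branches of the binary tree: \<open>\<alpha>\<close> is sent to a branch
  \<open>e \<alpha>\<close>, and its function lists codes of the initial segments of that branch.
  Two different branches share only finitely many of these.\<close>

lemma exists_eventually_different_functions_countable:
  fixes I :: "'i set" and \<kappa> :: "'k rel"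
  assumes I: "countable I" "infinite I" and \<kappa>: "\<kappa> \<le>o continuum"
  shows "\<exists>F :: 'k \<Rightarrow> 'i \<Rightarrow> 'i. (\<forall>\<alpha>\<in>Field \<kappa>. \<forall>i\<in>I. F \<alpha> i \<in> I) \<and>
    (\<forall>\<alpha>\<in>Field \<kappa>. \<forall>\<beta>\<in>Field \<kappa>. \<alpha> \<noteq> \<beta> \<longrightarrow> |{i \<in> I. F \<alpha> i = F \<beta> i}| <o |I| )"
proof -
  obtain e :: "'k \<Rightarrow> nat \<Rightarrow> bool" where e: "inj_on e (Field \<kappa>)"
    using card_of_mono2[OF \<kappa>] by (metis card_of_ordLeq)
  \<comment> \<open>The segment is one longer than the index of \<open>i\<close>, so it includes
    position \<open>k\<close> once that index is at least \<open>k\<close>. Agreement at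
    \<open>i\<close> therefore forces the index below a position where the branches differ.\<close>
  define F where
    "F \<alpha> i = from_nat_into I (to_nat (map (e \<alpha>) [0..<Suc (to_nat_on I i)]))" for \<alpha> i
  have "F \<alpha> i \<in> I" for \<alpha> i
    unfolding F_def using I by (intro from_nat_into) auto
  moreover have "|{i \<in> I. F \<alpha> i = F \<beta> i}| <o |I|"
    if ab: "\<alpha> \<in> Field \<kappa>" "\<beta> \<in> Field \<kappa>" "\<alpha> \<noteq> \<beta>" for \<alpha> \<beta>
  proof -
    obtain k where k: "e \<alpha> k \<noteq> e \<beta> k"
      using inj_onD[OF e, of \<alpha> \<beta>] ab by blast
    have "to_nat_on I i < k" if i: "i \<in> I" "F \<alpha> i = F \<beta> i" for i
    proof (rule ccontr)
      assume "\<not> to_nat_on I i < k"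
      then have "k \<in> set [0..<Suc (to_nat_on I i)]"
        by auto
      moreover have "map (e \<alpha>) [0..<Suc (to_nat_on I i)] = map (e \<beta>) [0..<Suc (to_nat_on I i)]"
        using i(2) I unfolding F_def by (metis from_nat_into_inj_infinite to_nat_split injD inj_to_nat)
      ultimately show False
        using k by (metis map_eq_conv)
    qed
    then have "to_nat_on I ` {i \<in> I. F \<alpha> i = F \<beta> i} \<subseteq> {..<k}"
      by auto
    moreover have "inj_on (to_nat_on I) {i \<in> I. F \<alpha> i = F \<beta> i}"
      using inj_on_to_nat_on[OF I(1)] by (rule inj_on_subset) auto
    ultimately have "finite {i \<in> I. F \<alpha> i = F \<beta> i}"
      using finite_imageD finite_subset by blast
    then show ?thesis
      using finite_ordLess_infinite[OF card_of_Well_order card_of_Well_order] I(2)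
      by (simp add: Field_card_of)
  qed
  ultimately show ?thesis by blast
qed

text \<open>The functions are built by diagonalisation: there are at most \<open>|I|\<close> predecessors, so
  they can be injected into \<open>I\<close>, and at \<open>i\<close> one avoids the fewer than \<open>|I|\<close> predecessors
  whose index is at most \<open>i\<close>.\<close>

lemma exists_eventually_different_functions_uncountable:
  fixes I :: "'i set" and \<kappa> :: "'k rel"
  assumes I: "omega1 \<le>o |I|" and \<kappa>: "Card_order \<kappa>" "\<kappa> \<le>o omega2"
  shows "\<exists>F :: 'k \<Rightarrow> 'i \<Rightarrow> 'i. (\<forall>\<alpha>\<in>Field \<kappa>. \<forall>i\<in>I. F \<alpha> i \<in> I) \<and>
    (\<forall>\<alpha>\<in>Field \<kappa>. \<forall>\<beta>\<in>Field \<kappa>. \<alpha> \<noteq> \<beta> \<longrightarrow> |{i \<in> I. F \<alpha> i = F \<beta> i}| <o |I| )"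
proof -
  have "natLeq \<le>o |I|"
    using I cardSuc_ordLeq[OF natLeq_Card_order] ordLeq_transitive by blast
  then have inf: "infinite I"
    using infinite_iff_natLeq_ordLeq by blast
  have wo: "Well_order \<kappa>"
    using \<kappa>(1) by (simp add: card_order_on_def)
  have tot: "(a, b) \<in> |I| \<or> (b, a) \<in> |I|" if "a \<in> I" "b \<in> I" for a b
    using wo_rel.TOTALS[OF wo_rel.intro[OF card_of_Well_order[of I]]] that
    by (simp only: Field_card_of)
  have under_less: "|under |I| i| <o |I|" if "i \<in> I" for i
    using card_of_under_ordLess[OF card_of_Card_order, of I i] inf that by (simp add: Field_card_of)
  \<comment> \<open>Fewer than \<open>omega2\<close> means at most \<open>omega1\<close>. The bound
    covers all \<open>\<alpha>\<close> of the type, since the recursion below runs over the whole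
    type.\<close>
  have small: "|underS \<kappa> \<alpha>| \<le>o |I|" for \<alpha>
  proof (cases "\<alpha> \<in> Field \<kappa>")
    case True
    then have "|underS \<kappa> \<alpha>| <o omega2"
      using card_of_underS[OF \<kappa>(1)] \<kappa>(2) ordLess_ordLeq_trans by blast
    then have "|underS \<kappa> \<alpha>| \<le>o omega1"
      using cardSuc_ordLeq_ordLess[OF cardSuc_Card_order[OF natLeq_Card_order] card_of_Card_order]
      by blast
    then show ?thesis
      using I ordLeq_transitive by blast
  next
    case False
    then show ?thesis by (simp add: underS_empty card_of_empty)
  qed
  define P where "P f \<alpha> g \<longleftrightarrow> (\<forall>i\<in>I. g i \<in> I) \<and> (\<forall>\<beta>\<in>underS \<kappa> \<alpha>. |{i \<in> I. g i = f \<beta> i}| <o |I| )"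
    for f :: "'k \<Rightarrow> 'i \<Rightarrow> 'i" and \<alpha> g
  have "\<exists>F. \<forall>\<alpha>. P F \<alpha> (F \<alpha>)"
  proof (rule dependent_wf_choice)
    show "wf (\<kappa> - Id)"
      using wo by (simp add: well_order_on_def)
  next
    fix f f' :: "'k \<Rightarrow> 'i \<Rightarrow> 'i" and \<alpha> g
    assume "\<And>\<beta>. (\<beta>, \<alpha>) \<in> \<kappa> - Id \<Longrightarrow> f \<beta> = f' \<beta>"
    then show "P f \<alpha> g = P f' \<alpha> g"
      by (simp add: P_def underS_def)
  next
    fix \<alpha> and f :: "'k \<Rightarrow> 'i \<Rightarrow> 'i"
    obtain j where j: "inj_on j (underS \<kappa> \<alpha>)" "j ` underS \<kappa> \<alpha> \<subseteq> I"
      using small[of \<alpha>] unfolding card_of_ordLeq[symmetric] by blast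
    define B where "B i = {\<beta> \<in> underS \<kappa> \<alpha>. (j \<beta>, i) \<in> |I| }" for i
    have "\<exists>y. y \<in> I - (\<lambda>\<beta>. f \<beta> i) ` B i" if i: "i \<in> I" for i
    proof -
      have "inj_on j (B i)" "j ` B i \<subseteq> under |I| i"
        using j by (auto simp: B_def under_def intro: inj_on_subset)
      then have "|B i| \<le>o |under |I| i|"
        unfolding card_of_ordLeq[symmetric] by blast
      then have "|(\<lambda>\<beta>. f \<beta> i) ` B i| <o |I|"
        using card_of_image[of _ "B i"] under_less[OF i] ordLeq_ordLess_trans ordLeq_transitive by metis
      then have "\<not> I \<subseteq> (\<lambda>\<beta>. f \<beta> i) ` B i"
        using card_of_mono1 not_ordLess_ordLeq by blast
      then show ?thesis by blast
    qed
    then obtain g where g: "\<And>i. i \<in> I \<Longrightarrow> g i \<in> I - (\<lambda>\<beta>. f \<beta> i) ` B i"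
      by metis
    have "|{i \<in> I. g i = f \<beta> i}| <o |I|" if \<beta>: "\<beta> \<in> underS \<kappa> \<alpha>" for \<beta>
    proof -
      \<comment> \<open>From index \<open>j \<beta>\<close> on, \<open>g\<close> avoids the values
        of \<open>f \<beta>\<close>, so agreement is confined to an initial segment of
        \<open>I\<close>.\<close>
      have "{i \<in> I. g i = f \<beta> i} \<subseteq> under |I| (j \<beta>)"
      proof
        fix i assume i: "i \<in> {i \<in> I. g i = f \<beta> i}"
        then have "(j \<beta>, i) \<notin> |I|"
          using g[of i] \<beta> by (auto simp: B_def)
        moreover have "j \<beta> \<in> I"
          using j \<beta> by blast
        ultimately show "i \<in> under |I| (j \<beta>)"
          using tot i unfolding under_def by blast
      qed
      moreover have "|under |I| (j \<beta>)| <o |I|"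
        using under_less j(2) \<beta> by blast
      ultimately show ?thesis
        by (rule ordLeq_ordLess_trans[OF card_of_mono1])
    qed
    then show "\<exists>g. P f \<alpha> g"
      using g unfolding P_def by (intro exI[of _ g]) blast
  qed
  then obtain F where F: "\<And>\<alpha>. P F \<alpha> (F \<alpha>)"
    by blast
  have "|{i \<in> I. F \<alpha> i = F \<beta> i}| <o |I|" if ab: "\<alpha> \<in> Field \<kappa>" "\<beta> \<in> Field \<kappa>" "\<alpha> \<noteq> \<beta>" for \<alpha> \<beta>
  proof -
    have "\<alpha> \<in> underS \<kappa> \<beta> \<or> \<beta> \<in> underS \<kappa> \<alpha>"
      using wo_rel.TOTALS[OF wo_rel.intro[OF wo]] ab unfolding underS_def by blast
    then show ?thesis
    proof
      assume "\<alpha> \<in> underS \<kappa> \<beta>"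
      then have "|{i \<in> I. F \<beta> i = F \<alpha> i}| <o |I|"
        using F[of \<beta>] by (simp only: P_def)
      then show ?thesis
        by (simp only: eq_commute[of "F \<beta> _"])
    next
      assume "\<beta> \<in> underS \<kappa> \<alpha>"
      then show ?thesis
        using F[of \<alpha>] by (simp only: P_def)
    qed
  qed
  moreover have "\<forall>\<alpha>\<in>Field \<kappa>. \<forall>i\<in>I. F \<alpha> i \<in> I"
    using F by (simp add: P_def)
  ultimately show ?thesis
    by (intro exI[of _ F]) blast
qed

text \<open>The size of \<open>I\<close> is not known in advance, hence two bounds on
  \<open>\<kappa>\<close>: coding branches uses the continuum for countable \<open>I\<close>,
  diagonalisation uses \<open>omega2\<close> for uncountable \<open>I\<close>.\<close>

lemma exists_eventually_different_functions:
  fixes I :: "'i set" and \<kappa> :: "'k rel"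
  assumes I: "infinite I" and \<kappa>: "Card_order \<kappa>" "\<kappa> \<le>o continuum" "\<kappa> \<le>o omega2"
  shows "\<exists>F :: 'k \<Rightarrow> 'i \<Rightarrow> 'i. (\<forall>\<alpha>\<in>Field \<kappa>. \<forall>i\<in>I. F \<alpha> i \<in> I) \<and>
    (\<forall>\<alpha>\<in>Field \<kappa>. \<forall>\<beta>\<in>Field \<kappa>. \<alpha> \<noteq> \<beta> \<longrightarrow> |{i \<in> I. F \<alpha> i = F \<beta> i}| <o |I| )"
proof (cases "countable I")
  case True
  then show ?thesis
    using exists_eventually_different_functions_countable I \<kappa>(2) by blast
next
  case False
  then have "natLeq <o |I|"
    using not_ordLeq_iff_ordLess[OF natLeq_Well_order card_of_Well_order[of I]]
    by (simp add: countable_card_le_natLeq)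
  then have "omega1 \<le>o |I|"
    by (intro cardSuc_least natLeq_Card_order card_of_Card_order)
  then show ?thesis
    using exists_eventually_different_functions_uncountable \<kappa> by blast
qed

section \<open>The construction in one nonempty open set\<close>

lemma exists_open_almost_resolvable:
  fixes \<kappa> :: "'k rel" and X :: "'a topology"
  assumes crowded: "crowded_space X" and mn: "monotonically_normal_space X"
    and nonempty: "topspace X \<noteq> {}"
    and \<kappa>: "Card_order \<kappa>" "\<kappa> \<le>o continuum" "\<kappa> \<le>o omega2"
  shows "\<exists>G (D :: 'k \<Rightarrow> 'a set). openin X G \<and> G \<noteq> {}
      \<and> (\<forall>\<alpha>\<in>Field \<kappa>. D \<alpha> \<subseteq> G \<and> G \<subseteq> X closure_of D \<alpha>)
      \<and> (\<forall>\<alpha>\<in>Field \<kappa>. \<forall>\<beta>\<in>Field \<kappa>. \<alpha> \<noteq> \<beta> \<longrightarrow> nowhere_dense_in X (D \<alpha> \<inter> D \<beta>))"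
proof -
  define Q where "Q = {F. (\<forall>A\<in>F. nowhere_dense_in X A) \<and> \<not> nowhere_dense_in X (\<Union>F)}"
  have t1: "t1_space X"
    using mn by (simp add: monotonically_normal_space_def)
  have "\<not> nowhere_dense_in X (topspace X)"
    using nonempty by (simp add: nowhere_dense_in_def)
  \<comment> \<open>The singletons show that \<open>Q\<close> is nonempty, so a member of least
    cardinality exists.\<close>
  then have single: "(\<lambda>x. {x}) ` topspace X \<in> Q"
    using crowded_nowhere_dense_in_singleton[OF crowded t1] by (simp add: Q_def)
  have "wf (inv_image ordLess (\<lambda>F :: 'a set set. |F| ))"
    by (intro wf_inv_image wf_ordLess)
  then obtain F where F: "F \<in> Q" "\<And>K. (K, F) \<in> inv_image ordLess (\<lambda>F. |F| ) \<Longrightarrow> K \<notin> Q"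
    using single by (rule wfE_min) (rule that)
  have nd: "nowhere_dense_in X A" if "A \<in> F" for A
    using F(1) that by (simp add: Q_def)
  \<comment> \<open>Minimality of \<open>F\<close>. The index type is left free because the fact is
    applied both to pairs and to members of \<open>F\<close>.\<close>
  have small: "nowhere_dense_in X (\<Union>k\<in>K. A k)"
    if K: "|K| <o |F|" "\<And>k. k \<in> K \<Longrightarrow> nowhere_dense_in X (A k)" for K :: "'j set" and A
  proof -
    have "|A ` K| <o |F|"
      using card_of_image K(1) by (rule ordLeq_ordLess_trans)
    then have "A ` K \<notin> Q"
      using F(2)[of "A ` K"] by simp
    then show ?thesis
      using K(2) by (simp add: Q_def)
  qed
  have inf: "infinite F"
    using F(1) nowhere_dense_in_Union_finite by (auto simp: Q_def)

  \<comment> \<open>As \<open>F\<close> is infinite, \<open>F \<times> F\<close> has the size of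
    \<open>F\<close>, so each pair has fewer than \<open>|F|\<close> predecessors and
    \<open>small\<close> applies to them.\<close>
  define r where "r = |F \<times> F|"
  have r: "Card_order r" "Field r = F \<times> F" "r =o |F|"
    unfolding r_def
    using card_of_Card_order Field_card_of card_of_Times_same_infinite[OF inf] .
  have wo: "Well_order r"
    using r(1) by (simp add: card_order_on_def)
  \<comment> \<open>The condition is vacuous off \<open>F \<times> F\<close>, which makes the
    recursion total on the type.\<close>
  define P where "P L p S \<longleftrightarrow> p \<in> F \<times> F \<longrightarrow>
      nowhere_dense_in X S \<and> fst p \<subseteq> X closure_of S \<and> (\<forall>q\<in>underS r p. S \<inter> L q = {})"
    for L :: "'a set \<times> 'a set \<Rightarrow> 'a set" and p S
  have "\<exists>L. \<forall>p. P L p (L p)"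
  proof (rule dependent_wf_choice)
    show "wf (r - Id)"
      using wo by (simp add: well_order_on_def)
  next
    fix L L' :: "'a set \<times> 'a set \<Rightarrow> 'a set" and p S
    assume "\<And>q. (q, p) \<in> r - Id \<Longrightarrow> L q = L' q"
    then show "P L p S = P L' p S"
      by (simp add: P_def underS_def)
  next
    fix p and L :: "'a set \<times> 'a set \<Rightarrow> 'a set"
    assume IH: "\<And>q. (q, p) \<in> r - Id \<Longrightarrow> P L q (L q)"
    show "\<exists>S. P L p S"
    proof (cases "p \<in> F \<times> F")
      case True
      have "|underS r p| <o |F|"
        using card_of_underS[OF r(1)] True r(2,3) ordLess_ordIso_trans by metis
      moreover have "nowhere_dense_in X (L q)" if "q \<in> underS r p" for q
        using IH[of q] that underS_Field[of q r p] r(2) unfolding P_def underS_def by blast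
      ultimately have "nowhere_dense_in X (\<Union>q\<in>underS r p. L q)"
        by (rule small)
      then have "nowhere_dense_in X (fst p \<union> (\<Union>q\<in>underS r p. L q))"
        using nd True by (intro nowhere_dense_in_Un) auto
      \<comment> \<open>Adding the earlier sets to \<open>fst p\<close> before taking an
        accumulating set yields disjointness from them together with accumulation at
        \<open>fst p\<close>.\<close>
      then obtain S where "nowhere_dense_in X S" "S \<inter> (fst p \<union> (\<Union>q\<in>underS r p. L q)) = {}"
        "fst p \<union> (\<Union>q\<in>underS r p. L q) \<subseteq> X closure_of S"
        using exists_nowhere_dense_accumulating[OF crowded mn] by metis
      then show ?thesis
        unfolding P_def by (intro exI[of _ S]) blast
    qed (simp add: P_def)
  qed
  then obtain L where L: "\<And>p. P L p (L p)"
    by blast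
  have L_nd: "nowhere_dense_in X (L (A, B))" and L_cl: "A \<subseteq> X closure_of L (A, B)"
    if "A \<in> F" "B \<in> F" for A B
    using L[of "(A, B)"] that by (simp_all add: P_def)
  have L_disj: "L p \<inter> L q = {}" if pq: "p \<in> F \<times> F" "q \<in> F \<times> F" "p \<noteq> q" for p q
  proof -
    have "p \<in> underS r q \<or> q \<in> underS r p"
      using wo_rel.TOTALS[OF wo_rel.intro[OF wo]] pq r(2) unfolding underS_def by blast
    then show ?thesis
      using L[of p] L[of q] pq unfolding P_def by blast
  qed

  obtain f :: "'k \<Rightarrow> 'a set \<Rightarrow> 'a set" where f: "\<forall>\<alpha>\<in>Field \<kappa>. \<forall>A\<in>F. f \<alpha> A \<in> F"
    and f_diff: "\<forall>\<alpha>\<in>Field \<kappa>. \<forall>\<beta>\<in>Field \<kappa>. \<alpha> \<noteq> \<beta> \<longrightarrow> |{A \<in> F. f \<alpha> A = f \<beta> A}| <o |F|"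
    using exists_eventually_different_functions[OF inf \<kappa>] by (elim exE conjE) (rule that)
  define G where "G = X interior_of (X closure_of \<Union>F)"
  define D where "D \<alpha> = G \<inter> (\<Union>A\<in>F. L (A, f \<alpha> A))" for \<alpha>
  have G: "openin X G"
    by (simp add: G_def)
  have "G \<noteq> {}"
    using F(1) by (auto simp: Q_def G_def nowhere_dense_in_def)
  moreover have "G \<subseteq> X closure_of D \<alpha>" if \<alpha>: "\<alpha> \<in> Field \<kappa>" for \<alpha>
  proof -
    have "A \<subseteq> X closure_of (\<Union>A\<in>F. L (A, f \<alpha> A))" if A: "A \<in> F" for A
    proof -
      have "L (A, f \<alpha> A) \<subseteq> (\<Union>A\<in>F. L (A, f \<alpha> A))"
        using A by blast
      then show ?thesis
        using L_cl[of A "f \<alpha> A"] f A \<alpha> closure_of_mono by blast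
    qed
    then have "X closure_of \<Union>F \<subseteq> X closure_of (\<Union>A\<in>F. L (A, f \<alpha> A))"
      by (intro closure_of_minimal) auto
    then have "G \<subseteq> X closure_of (\<Union>A\<in>F. L (A, f \<alpha> A))"
      unfolding G_def by (rule order_trans[OF interior_of_subset])
    \<comment> \<open>Since \<open>G\<close> is open, cutting a set down to \<open>G\<close> loses
      no closure points in \<open>G\<close>.\<close>
    then show ?thesis
      unfolding D_def using openin_Int_closure_of_subset[OF G, of "\<Union>A\<in>F. L (A, f \<alpha> A)"]
      by (simp only: Int_absorb2)
  qed
  moreover have "nowhere_dense_in X (D \<alpha> \<inter> D \<beta>)"
    if ab: "\<alpha> \<in> Field \<kappa>" "\<beta> \<in> Field \<kappa>" "\<alpha> \<noteq> \<beta>" for \<alpha> \<beta>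
  proof -
    have "nowhere_dense_in X (\<Union>A\<in>{A \<in> F. f \<alpha> A = f \<beta> A}. L (A, f \<alpha> A))"
      using f_diff f ab by (intro small L_nd) auto
    \<comment> \<open>The sets \<open>L p\<close> are pairwise disjoint, so a common point
      determines one pair: both functions have the same argument \<open>A\<close> and the same value
      there.\<close>
    moreover have "D \<alpha> \<inter> D \<beta> \<subseteq> (\<Union>A\<in>{A \<in> F. f \<alpha> A = f \<beta> A}. L (A, f \<alpha> A))"
    proof
      fix x assume "x \<in> D \<alpha> \<inter> D \<beta>"
      then obtain A B where AB: "A \<in> F" "x \<in> L (A, f \<alpha> A)" "B \<in> F" "x \<in> L (B, f \<beta> B)"
        unfolding D_def by blast
      then have "(A, f \<alpha> A) = (B, f \<beta> B)"
        using L_disj[of "(A, f \<alpha> A)" "(B, f \<beta> B)"] f ab(1,2) by (metis IntI SigmaI empty_iff)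
      then show "x \<in> (\<Union>A\<in>{A \<in> F. f \<alpha> A = f \<beta> A}. L (A, f \<alpha> A))"
        using AB by auto
    qed
    ultimately show ?thesis
      by (rule nowhere_dense_in_subset)
  qed
  ultimately show ?thesis
    using G by (intro exI[of _ G] exI[of _ D]) (simp add: D_def)
qed

section \<open>Localisation and comparison of cardinals\<close>

text \<open>The construction is run in each nonempty open subspace; closure points and nowhere dense
  sets of an open subspace remain such in \<open>X\<close>, so gluing applies.\<close>

lemma crowded_monotonically_normal_almost_resolvable:
  fixes \<kappa> :: "'k rel" and X :: "'a topology"
  assumes crowded: "crowded_space X" and mn: "monotonically_normal_space X"
    and \<kappa>: "Card_order \<kappa>" "\<kappa> \<le>o continuum" "\<kappa> \<le>o omega2"
  shows "almost_resolvable \<kappa> X"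
proof (rule almost_resolvable_if_locally)
  fix W assume W: "openin X W" "W \<noteq> {}"
  then have ne: "topspace (subtopology X W) \<noteq> {}"
    using openin_subset by fastforce
  obtain G and D :: "'k \<Rightarrow> 'a set" where
    G: "openin (subtopology X W) G" "G \<noteq> {}"
    and D: "\<forall>\<alpha>\<in>Field \<kappa>. D \<alpha> \<subseteq> G \<and> G \<subseteq> subtopology X W closure_of D \<alpha>"
    and DD: "\<forall>\<alpha>\<in>Field \<kappa>. \<forall>\<beta>\<in>Field \<kappa>. \<alpha> \<noteq> \<beta> \<longrightarrow>
      nowhere_dense_in (subtopology X W) (D \<alpha> \<inter> D \<beta>)"
    using exists_open_almost_resolvable[OF crowded_space_open_subtopology[OF W(1) crowded]
        monotonically_normal_open_subtopology[OF W(1) mn] ne \<kappa>]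
    by (elim exE conjE) (rule that)
  have "subtopology X W closure_of D \<alpha> \<subseteq> X closure_of D \<alpha>" for \<alpha>
    by (rule closure_of_subtopology_subset)
  then show "\<exists>G (D :: 'k \<Rightarrow> 'a set). openin X G \<and> G \<noteq> {} \<and> G \<subseteq> W
      \<and> (\<forall>\<alpha>\<in>Field \<kappa>. D \<alpha> \<subseteq> G \<and> G \<subseteq> X closure_of D \<alpha>)
      \<and> (\<forall>\<alpha>\<in>Field \<kappa>. \<forall>\<beta>\<in>Field \<kappa>. \<alpha> \<noteq> \<beta> \<longrightarrow> nowhere_dense_in X (D \<alpha> \<inter> D \<beta>))"
    using G D DD nowhere_dense_in_open_subtopology[OF W(1)] openin_open_subtopology[OF W(1)]
    by (intro exI[of _ G] exI[of _ D]) (meson order_trans)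
qed

theorem theorem2p5:
  fixes X :: "'a topology"
  assumes "crowded_space X"
    and "monotonically_normal_space X"
  shows "almost_resolvable (cmin continuum omega2) X
    \<and> almost_resolvable omega1 X
    \<and> (\<not> continuum =o omega1 \<longrightarrow> almost_resolvable omega2 X)"
proof -
  have card: "Card_order continuum" "Card_order omega1" "Card_order omega2"
    by (simp_all only: Card_order_cexp cardSuc_Card_order natLeq_Card_order)
  have wo: "Well_order continuum" "Well_order omega2"
    using card by (simp_all only: card_order_on_def)
  \<comment> \<open>Cantor's theorem puts the continuum strictly above
    \<open>natLeq\<close>.\<close>
  have o1: "omega1 \<le>o continuum"
    by (intro cardSuc_least natLeq_Card_order Card_order_cexp ordLess_ctwo_cexp)
  have o12: "omega1 \<le>o omega2"
    using cardSuc_ordLeq[OF card(2)] .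
  have "cmin continuum omega2 \<le>o continuum \<and> cmin continuum omega2 \<le>o omega2"
  proof (cases "continuum \<le>o omega2")
    case True
    then show ?thesis
      using cmin_ordIso(1)[OF card(1,3) True] ordIso_ordLeq_trans ordIso_iff_ordLeq by blast
  next
    case False
    then have le: "omega2 \<le>o continuum"
      using ordLeq_total[OF wo] by blast
    then show ?thesis
      using cmin_ordIso(2)[OF card(1,3) le] ordIso_ordLeq_trans ordIso_iff_ordLeq by blast
  qed
  then have "almost_resolvable (cmin continuum omega2) X"
    using crowded_monotonically_normal_almost_resolvable[OF assms Card_order_cmin[OF card(1,3)]]
    by blast
  moreover have "almost_resolvable omega1 X"
    using crowded_monotonically_normal_almost_resolvable[OF assms card(2) o1 o12] .
  moreover have "almost_resolvable omega2 X" if "\<not> continuum =o omega1"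
  proof -
    \<comment> \<open>Failure of the continuum hypothesis makes the inequality strict, so the
      continuum reaches the successor \<open>omega2\<close>.\<close>
    have "omega1 <o continuum"
      using o1 that ordLeq_iff_ordLess_or_ordIso ordIso_symmetric by blast
    then have "omega2 \<le>o continuum"
      using cardSuc_least card by blast
    moreover have "omega2 \<le>o omega2"
      using ordLeq_reflexive[OF wo(2)] .
    ultimately show ?thesis
      using crowded_monotonically_normal_almost_resolvable[OF assms card(3)] by blast
  qed
  ultimately show ?thesis by blast
qed

end
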